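(* Let $G=(V,E)$ be a directed graph with $n$ nodes and $m$ edges in which every node has out-degree at least $1$, and let $d=m/n$. Given threshold $\delta\in(0,1)$, teleport probability $\alpha\in(0,1)$, desired relative error $c\in(0,1)$, desired failure probability $p_f\in(0,1)$ and reverse threshold $\epsilon_r>0$, the Theoretical-FAST-PPR algorithm with parameters chosen as below requires (i) average reverse time (averaged over uniformly random pairs $(s,t)$) $O\big(\frac{d}{\alpha\beta\epsilon_r}\big)=O\big(\frac{d}{c\alpha\epsilon_r}\big)$, and (ii) average forward time (averaged over the randomness of the algorithm) at most $O\big(\frac{n_f}{\alpha p_{min}}\big)=O\Big(\frac{\log(1/p_f)\log(1/\delta)}{c^3\alpha\epsilon_f\log(1/(1-\alpha))}\Big)$.
   Context: Notation: $\mathcal{N}^{in}(u)$, $\mathcal{N}^{out}(u)$, $d^{out}(u)$ denote in-neighbourhood, out-neighbourhood and out-degree; $Geom(\alpha)$ is the distribution on $\{0,1,\dots\}$ with $\mathbb{P}[L=i]=\alpha(1-\alpha)^i$; $\pi_u(v)$ is the personalized PageRank (probability that the simple random walk from $u$, stopped after an independent $Geom(\alpha)$ number of steps, ends at $v$). Parameters: $\epsilon_f=\delta/\epsilon_r$, $\beta=\frac{c}{3+c}$, $p_{min}=\frac{c}{3(1+\beta)}$, $l_{max}=\log_{1-\alpha}(c\delta/3)$, $n_f=\frac{45\,l_{max}}{c^2\epsilon_f}\log(2/p_f)$. Reverse phase: run FRONTIER$(t,\epsilon_r,\beta)$: set $\epsilon_{inv}=\beta\epsilon_r$; initialise $\widehat{\pi}^{-1}_t$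 and residual $r_t$ to $0$ except $\widehat{\pi}^{-1}_t(t)=r_t(t)=\alpha$; $\widehat T_t=\{t\}$, $\widehat F_t=\emptyset$; while some $w$ has $r_t(w)>\alpha\epsilon_{inv}$: for each $u\in\mathcal{N}^{in}(w)$ add $\Delta=(1-\alpha)r_t(w)/d^{out}(u)$ to $\widehat{\pi}^{-1}_t(u)$ and $r_t(u)$, and if $\widehat{\pi}^{-1}_t(u)>\epsilon_r$ add $u$ to $\widehat T_t$ and $\mathcal{N}^{in}(u)$ to $\widehat F_t$; then set $r_t(w)=0$; finally $\widehat F_t:=\widehat F_t\setminus\widehat T_t$. The reverse time is the running time of this procedure (each push costs time proportional to the number of in-neighbours processed). Forward phase: let $T=\widehat T_t$ and, for $u\notin T$, $p_{\overline{T}}(u)=|\mathcal{N}^{out}(u)\setminus T|/d^{out}(u)$. For $i=1,\dots,n_f$: draw $L_i\sim Geom(\alpha)$ and generate a target-avoiding walk from $s$: at the current node $u$, stop if $p_{\overline{T}}(u)<p_{min}$ or if the number of steps taken equals $\min\{L_i,l_{max}\}$; otherwise repeatedly sample uniformly random out-neighbours of $u$ until one not in $T$ is found (rejection sampling) and move to it. Each walk then contributes a weighted sum of node scores (computed along the walk). The forward time is the total work of generating these $n_f$ walks, counting each neighbour sample and each step as $O(1)$.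
   Formalization: The last simplification of the forward bound in (ii) fails with one constant for all δ, p_f, c in (0,1) (e.g. p_f → 1); it is stated for δ, p_f ≤ q < 1 and c ≥ δ^κ, with a constant depending on q and κ, which are arbitrary. *)

theory Defs
  imports "HOL-Probability.Probability" "Graph_Theory.Digraph"
begin

definition in_nbrs :: "('a, 'b) pre_digraph \<Rightarrow> 'a \<Rightarrow> 'a set" where
  "in_nbrs G v = {u. u \<rightarrow>\<^bsub>G\<^esub> v}"

definition out_nbrs :: "('a, 'b) pre_digraph \<Rightarrow> 'a \<Rightarrow> 'a set" where
  "out_nbrs G u = {v. u \<rightarrow>\<^bsub>G\<^esub> v}"

definition avg_degree :: "('a, 'b) pre_digraph \<Rightarrow> real" where
  "avg_degree G = real (card (arcs G)) / real (card (verts G))"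


section \<open>Parameters\<close>

definition beta :: "real \<Rightarrow> real" where
  "beta c = c / (3 + c)"

definition p_min :: "real \<Rightarrow> real" where
  "p_min c = c / (3 * (1 + beta c))"

definition eps_f :: "real \<Rightarrow> real \<Rightarrow> real" where
  "eps_f \<delta> \<epsilon>r = \<delta> / \<epsilon>r"

definition l_max :: "real \<Rightarrow> real \<Rightarrow> real \<Rightarrow> real" where
  "l_max \<alpha> c \<delta> = log (1 - \<alpha>) (c * \<delta> / 3)"

definition n_f :: "real \<Rightarrow> real \<Rightarrow> real \<Rightarrow> real \<Rightarrow> real \<Rightarrow> real" where
  "n_f \<alpha> c \<delta> pf \<epsilon>r = 45 * l_max \<alpha> c \<delta> / (c\<^sup>2 * eps_f \<delta> \<epsilon>r) * ln (2 / pf)"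


section \<open>Reverse phase\<close>

record 'a frontier_state =
  estimate :: "'a \<Rightarrow> real"
  residual :: "'a \<Rightarrow> real"
  target :: "'a set"
  frontier :: "'a set"
  time :: nat

definition frontier_init :: "real \<Rightarrow> 'a \<Rightarrow> 'a frontier_state" where
  "frontier_init \<alpha> t =
    \<lparr> estimate = (\<lambda>_. 0)(t := \<alpha>), residual = (\<lambda>_. 0)(t := \<alpha>),
      target = {t}, frontier = {}, time = 0 \<rparr>"

text \<open>
  The loop body for one in-neighbour \<open>u\<close> of the pushed node \<open>w\<close>. It costs one unit, plus one
  unit per in-neighbour of \<open>u\<close> when these are inserted into the frontier. An
  in-neighbourhood that is already contained in the frontier is not traversed again.
  The residual of \<open>w\<close> is read anew for each \<open>u\<close>, which matters only for self-loops.
\<close>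

definition visit :: "('a, 'b) pre_digraph \<Rightarrow> real \<Rightarrow> real \<Rightarrow> 'a \<Rightarrow> 'a \<Rightarrow>
    'a frontier_state \<Rightarrow> 'a frontier_state" where
  "visit G \<alpha> \<epsilon>r w u X =
    (let \<Delta> = (1 - \<alpha>) * residual X w / real (out_degree G u);
         p = estimate X u + \<Delta>
     in \<lparr> estimate = (estimate X)(u := p),
          residual = (residual X)(u := residual X u + \<Delta>),
          target = (if p > \<epsilon>r then insert u (target X) else target X),
          frontier = (if p > \<epsilon>r then frontier X \<union> in_nbrs G u else frontier X),
          time = time X + 1 +
            (if p > \<epsilon>r \<and> \<not> in_nbrs G u \<subseteq> frontier X then card (in_nbrs G u) else 0) \<rparr>)"

text \<open>
  The list \<open>us\<close> is the order in which the in-neighbours of \<open>w\<close> are processed. Each push has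
  one unit of overhead, so that pushing a node without in-neighbours is not free.
\<close>

definition push :: "('a, 'b) pre_digraph \<Rightarrow> real \<Rightarrow> real \<Rightarrow> 'a \<Rightarrow> 'a list \<Rightarrow>
    'a frontier_state \<Rightarrow> 'a frontier_state" where
  "push G \<alpha> \<epsilon>r w us X =
    (let Y = fold (visit G \<alpha> \<epsilon>r w) us X
     in Y \<lparr> residual := (residual Y)(w := 0), time := time Y + 1 \<rparr>)"

definition frontier_step :: "('a, 'b) pre_digraph \<Rightarrow> real \<Rightarrow> real \<Rightarrow> real \<Rightarrow>
    'a frontier_state \<Rightarrow> 'a frontier_state \<Rightarrow> bool" where
  "frontier_step G \<alpha> \<epsilon>r b X Y \<longleftrightarrow>
    (\<exists>w us. w \<in> verts G \<and> residual X w > \<alpha> * (b * \<epsilon>r) \<and>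
            distinct us \<and> set us = in_nbrs G w \<and> Y = push G \<alpha> \<epsilon>r w us X)"

definition frontier_reaches :: "('a, 'b) pre_digraph \<Rightarrow> real \<Rightarrow> real \<Rightarrow> real \<Rightarrow> 'a \<Rightarrow>
    'a frontier_state \<Rightarrow> bool" where
  "frontier_reaches G \<alpha> \<epsilon>r b t X \<longleftrightarrow> (frontier_step G \<alpha> \<epsilon>r b)\<^sup>*\<^sup>* (frontier_init \<alpha> t) X"

text \<open>
  The final removal of the targets from the frontier is omitted: it affects no other
  component, and its cost is dominated by that of the insertions into the frontier.
\<close>

definition frontier_output :: "('a, 'b) pre_digraph \<Rightarrow> real \<Rightarrow> real \<Rightarrow> real \<Rightarrow> 'a \<Rightarrow>
    'a frontier_state \<Rightarrow> bool" where
  "frontier_output G \<alpha> \<epsilon>r b t X \<longleftrightarrow>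
    frontier_reaches G \<alpha> \<epsilon>r b t X \<and> (\<forall>w\<in>verts G. residual X w \<le> \<alpha> * (b * \<epsilon>r))"

text \<open>
  The running time is the worst case over all orders in which nodes and their in-neighbours
  can be processed. It is infinite if the loop can run forever, as each push takes
  positive time.
\<close>

definition reverse_time :: "('a, 'b) pre_digraph \<Rightarrow> real \<Rightarrow> real \<Rightarrow> real \<Rightarrow> 'a \<Rightarrow> ennreal" where
  "reverse_time G \<alpha> \<epsilon>r b t = (SUP X\<in>{X. frontier_reaches G \<alpha> \<epsilon>r b t X}. of_nat (time X))"

definition avg_reverse_time :: "('a, 'b) pre_digraph \<Rightarrow> real \<Rightarrow> real \<Rightarrow> real \<Rightarrow> ennreal" where
  "avg_reverse_time G \<alpha> \<epsilon>r b =
    (\<integral>\<^sup>+ (s, t). reverse_time G \<alpha> \<epsilon>r b t \<partial>measure_pmf (pmf_of_set (verts G \<times> verts G)))"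


section \<open>Forward phase\<close>

definition p_avoid :: "('a, 'b) pre_digraph \<Rightarrow> 'a set \<Rightarrow> 'a \<Rightarrow> real" where
  "p_avoid G T u = real (card (out_nbrs G u - T)) / real (out_degree G u)"

text \<open>Rejection sampling, returning the accepted node and the number of samples drawn.\<close>

partial_function (spmf) sample_avoiding :: "'a set \<Rightarrow> 'a set \<Rightarrow> ('a \<times> nat) spmf" where
  "sample_avoiding A T = do {
     v \<leftarrow> spmf_of_set A;
     if v \<notin> T then return_spmf (v, 1)
     else do {
       (v', k) \<leftarrow> sample_avoiding A T;
       return_spmf (v', k + 1)
     }
   }"

text \<open>
  The walk continued from \<open>u\<close> after \<open>j\<close> steps, with bound \<open>b\<close> on the number of steps, and the
  work it takes. The bound is a real number because \<^const>\<open>l_max\<close> need not be integral.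
\<close>

partial_function (spmf) avoiding_walk :: "('a, 'b) pre_digraph \<Rightarrow> 'a set \<Rightarrow> real \<Rightarrow> real \<Rightarrow>
    'a \<Rightarrow> nat \<Rightarrow> ('a list \<times> nat) spmf" where
  "avoiding_walk G T pm b u j =
    (if p_avoid G T u < pm \<or> real j \<ge> b then return_spmf ([u], 0)
     else do {
       (v, k) \<leftarrow> sample_avoiding (out_nbrs G u) T;
       (vs, x) \<leftarrow> avoiding_walk G T pm b v (Suc j);
       return_spmf (u # vs, k + 1 + x)
     })"

text \<open>
  The total work of generating \<open>N\<close> walks from \<open>s\<close>, with one unit per walk for drawing its
  length. The node scores do not influence the walks, and computing them is part of the unit
  cost of a step.
\<close>

primrec forward_work :: "('a, 'b) pre_digraph \<Rightarrow> 'a set \<Rightarrow> real \<Rightarrow> real \<Rightarrow> real \<Rightarrow>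
    'a \<Rightarrow> nat \<Rightarrow> nat spmf" where
  "forward_work G T \<alpha> pm lm s 0 = return_spmf 0"
| "forward_work G T \<alpha> pm lm s (Suc N) = do {
     L \<leftarrow> spmf_of_pmf (geometric_pmf \<alpha>);
     (vs, x) \<leftarrow> avoiding_walk G T pm (min (real L) lm) s 0;
     y \<leftarrow> forward_work G T \<alpha> pm lm s N;
     return_spmf (1 + x + y)
   }"

text \<open>A computation that fails to terminate with positive probability has infinite expected work.\<close>

definition expected_work :: "nat spmf \<Rightarrow> ennreal" where
  "expected_work p = (\<integral>\<^sup>+ x. (case x of None \<Rightarrow> \<infinity> | Some k \<Rightarrow> of_nat k) \<partial>measure_pmf p)"

text \<open>The walks are indexed by the integers \<open>i\<close> with \<open>1 \<le> i \<le> n_f\<close>.\<close>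

definition avg_forward_time :: "('a, 'b) pre_digraph \<Rightarrow> 'a set \<Rightarrow>
    real \<Rightarrow> real \<Rightarrow> real \<Rightarrow> real \<Rightarrow> real \<Rightarrow> 'a \<Rightarrow> ennreal" where
  "avg_forward_time G T \<alpha> c \<delta> pf \<epsilon>r s =
    expected_work (forward_work G T \<alpha> (p_min c) (l_max \<alpha> c \<delta>) s (nat \<lfloor>n_f \<alpha> c \<delta> pf \<epsilon>r\<rfloor>))"

end

theory Submission
  imports Defs
begin

text \<open>
  Reverse phase: let \<open>S v\<close> be the total residual ever removed from \<open>v\<close>, so that the estimate
  of \<open>v\<close> is \<open>S v\<close> plus its current residual. Pushes preserve
  \<open>S v + (\<Sum>w. \<pi> v w * residual w) / \<alpha> \<le> \<pi> v t\<close>. Each push of \<open>v\<close> adds more than \<open>\<alpha> * \<beta> * \<epsilon>r\<close> to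
  \<open>S v\<close>, so \<open>v\<close> is pushed at most \<open>\<pi> v t / (\<alpha> * \<beta> * \<epsilon>r)\<close> times; the in-neighbourhood of \<open>v\<close> is
  inserted into the frontier at most once, and only if \<open>\<pi> v t > \<epsilon>r\<close>. Averaging over \<open>t\<close> and using
  \<open>(\<Sum>t. \<pi> v t) \<le> 1\<close> leaves a multiple of \<open>(n + m) / n \<le> 2 * d\<close>.

  Forward phase: rejection sampling at a node that is not abandoned takes at most \<open>1 / p_min\<close>
  samples in expectation, and a walk has at most \<open>L\<close> steps, with mean \<open>(1 - \<alpha>) / \<alpha>\<close>.
\<close>

section \<open>Neighbourhoods, degree sums and the average degree\<close>

context fin_digraph
begin

lemma in_nbrs_subset: "in_nbrs G v \<subseteq> verts G"
  by (auto simp: in_nbrs_def)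

lemma finite_in_nbrs [simp]: "finite (in_nbrs G v)"
  by (rule finite_subset[OF in_nbrs_subset finite_verts])

lemma out_nbrs_subset: "out_nbrs G v \<subseteq> verts G"
  by (auto simp: out_nbrs_def)

lemma finite_out_nbrs [simp]: "finite (out_nbrs G v)"
  by (rule finite_subset[OF out_nbrs_subset finite_verts])

lemma card_in_nbrs_le: "card (in_nbrs G v) \<le> in_degree G v"
proof -
  have "in_nbrs G v = tail G ` in_arcs G v"
    by (auto simp: in_nbrs_def arcs_ends_def arc_to_ends_def)
  moreover have "finite (in_arcs G v)" by (simp add: in_arcs_def)
  ultimately show ?thesis by (simp add: in_degree_def card_image_le)
qed

lemma card_out_nbrs_le: "card (out_nbrs G v) \<le> out_degree G v"
proof -
  have "out_nbrs G v = head G ` out_arcs G v"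
    by (auto simp: out_nbrs_def arcs_ends_def arc_to_ends_def)
  moreover have "finite (out_arcs G v)" by (simp add: out_arcs_def)
  ultimately show ?thesis by (simp add: out_degree_def card_image_le)
qed

lemma sum_in_degree: "(\<Sum>v\<in>verts G. in_degree G v) = card (arcs G)"
proof -
  have "arcs G = (\<Union>v\<in>verts G. in_arcs G v)" by auto
  then have "card (arcs G) = card (\<Union>v\<in>verts G. in_arcs G v)" by simp
  also have "\<dots> = (\<Sum>v\<in>verts G. card (in_arcs G v))"
    by (rule card_UN_disjoint) auto
  finally show ?thesis by (simp add: in_degree_def)
qed

lemma sum_out_degree: "(\<Sum>v\<in>verts G. out_degree G v) = card (arcs G)"
proof -
  have "arcs G = (\<Union>v\<in>verts G. out_arcs G v)" by auto
  then have "card (arcs G) = card (\<Union>v\<in>verts G. out_arcs G v)" by simp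
  also have "\<dots> = (\<Sum>v\<in>verts G. card (out_arcs G v))"
    by (rule card_UN_disjoint) auto
  finally show ?thesis by (simp add: out_degree_def)
qed

text \<open>Lets the unit overhead per node be absorbed into the number of arcs in the reverse
  bound.\<close>

lemma avg_degree_ge_1:
  assumes "verts G \<noteq> {}" "\<forall>v\<in>verts G. out_degree G v \<ge> 1"
  shows "avg_degree G \<ge> 1"
proof -
  have "card (verts G) = (\<Sum>v\<in>verts G. 1)" by simp
  also have "\<dots> \<le> (\<Sum>v\<in>verts G. out_degree G v)" using assms(2) by (intro sum_mono) auto
  finally have "card (verts G) \<le> card (arcs G)" by (simp add: sum_out_degree)
  moreover have "card (verts G) > 0" using assms(1) by (simp add: card_gt_0_iff)
  ultimately show ?thesis by (simp add: avg_degree_def)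
qed

end


section \<open>Personalized PageRank\<close>

text \<open>The recursion extends a walk at its end, so it sums over \<open>in_nbrs G w\<close>, the
  nodes visited by a push of \<open>w\<close>. Mass is lost at sinks and on parallel arcs, so the
  total is only bounded by 1.\<close>

primrec walk_prob :: "('a, 'b) pre_digraph \<Rightarrow> nat \<Rightarrow> 'a \<Rightarrow> 'a \<Rightarrow> real" where
  "walk_prob G 0 v w = of_bool (v = w)"
| "walk_prob G (Suc k) v w = (\<Sum>x\<in>in_nbrs G w. walk_prob G k v x / real (out_degree G x))"

text \<open>The weight \<open>\<alpha> * (1 - \<alpha>) ^ k\<close> is the probability that the walk
  stops after exactly \<open>k\<close> steps.\<close>

definition ppr :: "('a, 'b) pre_digraph \<Rightarrow> real \<Rightarrow> 'a \<Rightarrow> 'a \<Rightarrow> real" where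
  "ppr G \<alpha> v w = (\<Sum>k. \<alpha> * (1 - \<alpha>) ^ k * walk_prob G k v w)"

lemma walk_prob_nonneg: "walk_prob G k v w \<ge> 0"
  by (induction k arbitrary: w) (auto intro!: sum_nonneg)

context fin_digraph
begin

text \<open>Grouping arcs by tail instead of head, \<open>x\<close> passes on the fraction
  \<open>card (out_nbrs G x) / out_degree G x\<close> of its mass. This is at most 1, and 0 at a
  sink by the convention for division by zero.\<close>

lemma sum_walk_prob_le: "(\<Sum>w\<in>verts G. walk_prob G k v w) \<le> 1"
proof (induction k)
  case 0
  have "(\<Sum>w\<in>verts G. of_bool (v = w)) = (if v \<in> verts G then 1 else 0 :: real)"
    by (simp add: of_bool_def)
  then show ?case by simp
next
  case (Suc k)
  let ?q = "\<lambda>x. walk_prob G k v x / real (out_degree G x)"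
  have "(\<Sum>w\<in>verts G. walk_prob G (Suc k) v w) = (\<Sum>w\<in>verts G. \<Sum>x\<in>{x\<in>verts G. x \<rightarrow>\<^bsub>G\<^esub> w}. ?q x)"
    using in_nbrs_subset by (auto simp: in_nbrs_def intro!: sum.cong)
  also have "\<dots> = (\<Sum>x\<in>verts G. \<Sum>w\<in>{w\<in>verts G. x \<rightarrow>\<^bsub>G\<^esub> w}. ?q x)"
    by (rule sum.swap_restrict) auto
  also have "\<dots> = (\<Sum>x\<in>verts G. real (card (out_nbrs G x)) * ?q x)"
  proof (rule sum.cong)
    fix x
    have "{w\<in>verts G. x \<rightarrow>\<^bsub>G\<^esub> w} = out_nbrs G x"
      using out_nbrs_subset[of x] by (auto simp: out_nbrs_def)
    then show "(\<Sum>w\<in>{w\<in>verts G. x \<rightarrow>\<^bsub>G\<^esub> w}. ?q x) = real (card (out_nbrs G x)) * ?q x"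
      by simp
  qed simp
  also have "\<dots> \<le> (\<Sum>x\<in>verts G. walk_prob G k v x)"
  proof (rule sum_mono)
    fix x
    have "real (card (out_nbrs G x)) / real (out_degree G x) \<le> 1"
      using card_out_nbrs_le[of x] by (cases "out_degree G x = 0") auto
    then show "real (card (out_nbrs G x)) * ?q x \<le> walk_prob G k v x"
      using mult_right_mono[OF _ walk_prob_nonneg[of G k v x]] by fastforce
  qed
  finally show ?case using Suc by simp
qed

lemma walk_prob_le_1:
  assumes "w \<in> verts G"
  shows "walk_prob G k v w \<le> 1"
proof -
  have "walk_prob G k v w \<le> (\<Sum>w\<in>verts G. walk_prob G k v w)"
    using assms by (intro member_le_sum) (auto simp: walk_prob_nonneg)
  with sum_walk_prob_le show ?thesis by (rule order_trans[rotated])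
qed

context
  fixes \<alpha> :: real
  assumes \<alpha>: "\<alpha> \<in> {0<..<1}"
begin

lemma geometric_weights_sums: "(\<lambda>k. \<alpha> * (1 - \<alpha>) ^ k) sums 1"
  using sums_mult[OF geometric_sums[of "1 - \<alpha>"], of \<alpha>] \<alpha> by simp

lemma summable_ppr:
  assumes "w \<in> verts G"
  shows "summable (\<lambda>k. \<alpha> * (1 - \<alpha>) ^ k * walk_prob G k v w)"
proof (rule summable_comparison_test'[OF sums_summable[OF geometric_weights_sums]])
  show "norm (\<alpha> * (1 - \<alpha>) ^ k * walk_prob G k v w) \<le> \<alpha> * (1 - \<alpha>) ^ k" for k
    using \<alpha> walk_prob_le_1[OF assms, of k v] walk_prob_nonneg[of G k v w]
    by (simp add: abs_mult mult_left_le)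
qed

lemma ppr_nonneg: "w \<in> verts G \<Longrightarrow> ppr G \<alpha> v w \<ge> 0"
  unfolding ppr_def using \<alpha> by (intro suminf_nonneg summable_ppr) (auto simp: walk_prob_nonneg)

text \<open>Each walk law has mass at most 1 and the geometric weights sum to 1. Summation over
  targets thereby eliminates PageRank from the average reverse time.\<close>

lemma sum_ppr_le: "(\<Sum>w\<in>verts G. ppr G \<alpha> v w) \<le> 1"
proof -
  have "(\<Sum>w\<in>verts G. ppr G \<alpha> v w) = (\<Sum>k. \<Sum>w\<in>verts G. \<alpha> * (1 - \<alpha>) ^ k * walk_prob G k v w)"
    unfolding ppr_def by (rule suminf_sum[symmetric]) (rule summable_ppr)
  also have "\<dots> \<le> (\<Sum>k. \<alpha> * (1 - \<alpha>) ^ k)"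
  proof (rule suminf_le)
    show "(\<Sum>w\<in>verts G. \<alpha> * (1 - \<alpha>) ^ k * walk_prob G k v w) \<le> \<alpha> * (1 - \<alpha>) ^ k" for k
      using \<alpha> sum_walk_prob_le[of k v] by (simp add: sum_distrib_left[symmetric] mult_left_le)
    show "summable (\<lambda>k. \<Sum>w\<in>verts G. \<alpha> * (1 - \<alpha>) ^ k * walk_prob G k v w)"
      by (intro summable_sum summable_ppr)
  qed (rule sums_summable[OF geometric_weights_sums])
  finally show ?thesis using sums_unique[OF geometric_weights_sums] by simp
qed

text \<open>Splits off the walk of length 0 and otherwise conditions on the last step. The factor
  \<open>(1 - \<alpha>) / out_degree G x\<close> is the one by which \<open>visit\<close> scales a
  residual, so pushes balance against this identity.\<close>

lemma ppr_unfold: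
  assumes "w \<in> verts G"
  shows "ppr G \<alpha> v w = \<alpha> * of_bool (v = w)
    + (\<Sum>x\<in>in_nbrs G w. ppr G \<alpha> v x * ((1 - \<alpha>) / real (out_degree G x)))"
proof -
  let ?f = "\<lambda>k x. \<alpha> * (1 - \<alpha>) ^ k * walk_prob G k v x"
  have sm: "summable (\<lambda>k. ?f k x)" if "x \<in> in_nbrs G w" for x
    using that in_nbrs_subset by (intro summable_ppr) auto
  have "ppr G \<alpha> v w = ?f 0 w + (\<Sum>k. ?f (Suc k) w)"
    unfolding ppr_def using suminf_split_head[OF summable_ppr[OF assms, of v]] by simp
  also have "(\<Sum>k. ?f (Suc k) w)
      = (\<Sum>k. \<Sum>x\<in>in_nbrs G w. ?f k x * ((1 - \<alpha>) / real (out_degree G x)))"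
    by (simp add: sum_distrib_left mult_ac)
  also have "\<dots> = (\<Sum>x\<in>in_nbrs G w. \<Sum>k. ?f k x * ((1 - \<alpha>) / real (out_degree G x)))"
    by (intro suminf_sum summable_mult2 sm)
  also have "\<dots> = (\<Sum>x\<in>in_nbrs G w. ppr G \<alpha> v x * ((1 - \<alpha>) / real (out_degree G x)))"
    unfolding ppr_def by (intro sum.cong refl suminf_mult2[symmetric] sm)
  finally show ?thesis by simp
qed

text \<open>The walk from \<open>v\<close> stops at once with probability \<alpha>. This later lets
  the potential bound the residual of \<open>v\<close> itself.\<close>

lemma ppr_self_ge:
  assumes "v \<in> verts G"
  shows "ppr G \<alpha> v v \<ge> \<alpha>"
proof -
  have "0 \<le> (\<Sum>x\<in>in_nbrs G v. ppr G \<alpha> v x * ((1 - \<alpha>) / real (out_degree G x)))"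
    using \<alpha> in_nbrs_subset by (intro sum_nonneg mult_nonneg_nonneg ppr_nonneg) auto
  then show ?thesis by (subst ppr_unfold[OF assms]) simp
qed

end

end


section \<open>Reverse phase\<close>

text \<open>The state keeps no history of insertions into the frontier. This set contains every node
  whose in-neighbourhood has been paid for, and perhaps others, which is harmless for an upper
  bound.\<close>

definition expanded :: "('a, 'b) pre_digraph \<Rightarrow> real \<Rightarrow> 'a frontier_state \<Rightarrow> 'a set" where
  "expanded G \<epsilon>r X = {u\<in>verts G. estimate X u > \<epsilon>r \<and> in_nbrs G u \<subseteq> frontier X}"

definition expansion_cost :: "('a, 'b) pre_digraph \<Rightarrow> real \<Rightarrow> 'a frontier_state \<Rightarrow> nat" where
  "expansion_cost G \<epsilon>r X = (\<Sum>u\<in>expanded G \<epsilon>r X. card (in_nbrs G u))"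

section \<open>Time and residual flow within one push\<close>

context fin_digraph
begin

lemma finite_expanded [simp]: "finite (expanded G \<epsilon>r X)"
  by (simp add: expanded_def)

text \<open>Estimates and frontier only grow, so \<open>expanded\<close> grows too, and a visit that
  pays for an insertion adds \<open>u\<close> to it. Hence time minus expansion cost rises by at
  most 1; the additive form avoids subtraction on naturals.\<close>

lemma visit_time:
  assumes "u \<in> verts G" "\<alpha> \<in> {0<..<1}" "residual X w \<ge> 0"
  shows "time (visit G \<alpha> \<epsilon>r w u X) + expansion_cost G \<epsilon>r X
    \<le> time X + 1 + expansion_cost G \<epsilon>r (visit G \<alpha> \<epsilon>r w u X)"
proof -
  let ?Y = "visit G \<alpha> \<epsilon>r w u X"
  have est: "estimate X x \<le> estimate ?Y x" for x
    using assms by (simp add: visit_def Let_def)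
  have sub: "expanded G \<epsilon>r X \<subseteq> expanded G \<epsilon>r ?Y"
  proof
    fix x assume "x \<in> expanded G \<epsilon>r X"
    then show "x \<in> expanded G \<epsilon>r ?Y"
      using est[of x] by (auto simp: expanded_def visit_def Let_def)
  qed
  show ?thesis
  proof (cases "estimate ?Y u > \<epsilon>r \<and> \<not> in_nbrs G u \<subseteq> frontier X")
    case True
    then have "u \<notin> expanded G \<epsilon>r X" "u \<in> expanded G \<epsilon>r ?Y"
      using assms by (auto simp: expanded_def visit_def Let_def)
    with sub have "insert u (expanded G \<epsilon>r X) \<subseteq> expanded G \<epsilon>r ?Y" by auto
    then have "(\<Sum>x\<in>insert u (expanded G \<epsilon>r X). card (in_nbrs G x)) \<le> expansion_cost G \<epsilon>r ?Y"
      unfolding expansion_cost_def by (intro sum_mono2) auto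
    then have "card (in_nbrs G u) + expansion_cost G \<epsilon>r X \<le> expansion_cost G \<epsilon>r ?Y"
      using \<open>u \<notin> _\<close> by (simp add: expansion_cost_def)
    moreover have "time ?Y = time X + 1 + card (in_nbrs G u)"
      using True by (simp add: visit_def Let_def)
    ultimately show ?thesis by linarith
  next
    case False
    then have "time ?Y = time X + 1" by (auto simp: visit_def Let_def)
    moreover have "expansion_cost G \<epsilon>r X \<le> expansion_cost G \<epsilon>r ?Y"
      unfolding expansion_cost_def using sub by (intro sum_mono2) auto
    ultimately show ?thesis by simp
  qed
qed

text \<open>
  The number \<open>a\<close> accounts for a self-loop at \<open>w\<close>, whose visit raises the residual of \<open>w\<close>
  in the middle of the push.
\<close>

lemma fold_visit:
  fixes \<alpha> \<epsilon>r :: real and w :: 'a and us :: "'a list" and X :: "'a frontier_state"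
  assumes "\<alpha> \<in> {0<..<1}" "\<And>x. residual X x \<ge> 0" "distinct us" "set us \<subseteq> verts G"
  defines "a \<equiv> (if w \<in> set us then (1 - \<alpha>) / real (out_degree G w) else 0)"
  defines "Y \<equiv> fold (visit G \<alpha> \<epsilon>r w) us X"
  shows "residual Y w = residual X w * (1 + a)"
    and "estimate Y u - residual Y u = estimate X u - residual X u"
    and "residual X u \<le> residual Y u"
    and "u \<noteq> w \<Longrightarrow> residual Y u \<le> residual X u
      + of_bool (u \<in> set us) * (residual X w * (1 + a) * ((1 - \<alpha>) / real (out_degree G u)))"
    and "time Y + expansion_cost G \<epsilon>r X \<le> time X + length us + expansion_cost G \<epsilon>r Y"
proof -
  let ?a = "\<lambda>vs. if w \<in> set vs then (1 - \<alpha>) / real (out_degree G w) else 0"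
  let ?Y = "\<lambda>vs. fold (visit G \<alpha> \<epsilon>r w) vs X"
  \<comment> \<open>The claims are proved together because each visit reads the current residual of
    \<open>w\<close>. Induction from the right isolates the visit that \<open>fold\<close> performs
    last.\<close>
  have "residual (?Y us) w = residual X w * (1 + ?a us) \<and>
    (\<forall>u. estimate (?Y us) u - residual (?Y us) u = estimate X u - residual X u) \<and>
    (\<forall>u. residual X u \<le> residual (?Y us) u) \<and>
    (\<forall>u. u \<noteq> w \<longrightarrow> residual (?Y us) u \<le> residual X u
      + of_bool (u \<in> set us) * (residual X w * (1 + ?a us) * ((1 - \<alpha>) / real (out_degree G u)))) \<and>
    time (?Y us) + expansion_cost G \<epsilon>r X \<le> time X + length us + expansion_cost G \<epsilon>r (?Y us)"
    using assms(3,4)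
  proof (induction us rule: rev_induct)
    case Nil
    show ?case by simp
  next
    case (snoc v vs)
    define Y where "Y = ?Y vs"
    define Z where "Z = visit G \<alpha> \<epsilon>r w v Y"
    define \<Delta> where "\<Delta> = residual Y w * ((1 - \<alpha>) / real (out_degree G v))"
    have Z: "?Y (vs @ [v]) = Z" by (simp add: Z_def Y_def)
    have v: "v \<notin> set vs" "v \<in> verts G" using snoc.prems by auto
    have res: "residual Z = (residual Y)(v := residual Y v + \<Delta>)"
      and est: "estimate Z = (estimate Y)(v := estimate Y v + \<Delta>)"
      by (simp_all add: Z_def visit_def Let_def \<Delta>_def mult_ac)
    have IH: "residual Y w = residual X w * (1 + ?a vs)"
      "\<And>u. estimate Y u - residual Y u = estimate X u - residual X u"
      "\<And>u. residual X u \<le> residual Y u"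
      "\<And>u. u \<noteq> w \<Longrightarrow> residual Y u \<le> residual X u
      + of_bool (u \<in> set vs) * (residual X w * (1 + ?a vs) * ((1 - \<alpha>) / real (out_degree G u)))"
      "time Y + expansion_cost G \<epsilon>r X \<le> time X + length vs + expansion_cost G \<epsilon>r Y"
      using snoc by (auto simp: Y_def)
    have rw: "residual Y w \<ge> 0" using IH(3)[of w] assms(2)[of w] by linarith
    have \<Delta>: "\<Delta> \<ge> 0" using rw assms(1) by (simp add: \<Delta>_def)
    have 1: "residual Z w = residual X w * (1 + ?a (vs @ [v]))"
      using v IH(1) by (auto simp: res \<Delta>_def algebra_simps)
    have 2: "estimate Z u - residual Z u = estimate X u - residual X u" for u
      using IH(2)[of u] by (auto simp: est res)
    have 3: "residual X u \<le> residual Z u" for u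
      using IH(3)[of u] \<Delta> by (auto simp: res)
    \<comment> \<open>The factor stays 1 until \<open>w\<close> itself is visited, so appending
      \<open>v\<close> can only raise it.\<close>
    have a_mono: "residual X w * (1 + ?a vs) * ((1 - \<alpha>) / real (out_degree G u))
        \<le> residual X w * (1 + ?a (vs @ [v])) * ((1 - \<alpha>) / real (out_degree G u))" for u
      using assms(1) assms(2)[of w] by (intro mult_right_mono mult_left_mono) auto
    have 4: "residual Z u \<le> residual X u + of_bool (u \<in> set (vs @ [v]))
        * (residual X w * (1 + ?a (vs @ [v])) * ((1 - \<alpha>) / real (out_degree G u)))" if "u \<noteq> w" for u
    proof (cases "u = v")
      case True
      have "residual Z u = residual Y u + \<Delta>" using True by (simp add: res)
      \<comment> \<open>By distinctness \<open>v\<close> has not been visited before, so the bound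
        for \<open>vs\<close> carries no extra term.\<close>
      also have "\<dots> \<le> residual X u + \<Delta>" using IH(4)[OF that] v True by simp
      also have "\<Delta> \<le> residual X w * (1 + ?a (vs @ [v])) * ((1 - \<alpha>) / real (out_degree G u))"
        using a_mono[of u] True unfolding \<Delta>_def IH(1) by simp
      finally show ?thesis using True by simp
    next
      case False
      show ?thesis
      proof (cases "u \<in> set vs")
        case True
        with False IH(4)[OF that] a_mono[of u] show ?thesis by (simp only: res) simp
      next
        case F: False
        with False IH(4)[OF that] show ?thesis by (simp add: res)
      qed
    qed
    have 5: "time Z + expansion_cost G \<epsilon>r X \<le> time X + length (vs @ [v]) + expansion_cost G \<epsilon>r Z"
      using IH(5) visit_time[of v \<alpha> Y w \<epsilon>r] v assms(1) rw by (simp add: Z_def)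
    show ?case unfolding Z using 1 2 3 4 5 by blast
  qed
  then show "residual Y w = residual X w * (1 + a)"
    and "estimate Y u - residual Y u = estimate X u - residual X u"
    and "residual X u \<le> residual Y u"
    and "u \<noteq> w \<Longrightarrow> residual Y u \<le> residual X u
      + of_bool (u \<in> set us) * (residual X w * (1 + a) * ((1 - \<alpha>) / real (out_degree G u)))"
    and "time Y + expansion_cost G \<epsilon>r X \<le> time X + length us + expansion_cost G \<epsilon>r Y"
    unfolding Y_def a_def by blast+
qed

end

text \<open>
  The difference \<open>estimate X v - residual X v\<close> is the total residual removed from \<open>v\<close> so far.
  The potential bound is an equality in the absence of self-loops; a push of a node with a
  self-loop discards part of its residual.
\<close>

definition frontier_inv :: "('a, 'b) pre_digraph \<Rightarrow> real \<Rightarrow> real \<Rightarrow> real \<Rightarrow> 'a \<Rightarrow>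
    'a frontier_state \<Rightarrow> bool" where
  "frontier_inv G \<alpha> \<epsilon>r b t X \<longleftrightarrow>
    (\<forall>v. 0 \<le> residual X v \<and> residual X v \<le> estimate X v) \<and>
    (\<forall>v\<in>verts G. estimate X v - residual X v + (\<Sum>w\<in>verts G. ppr G \<alpha> v w * residual X w) / \<alpha>
        \<le> ppr G \<alpha> v t) \<and>
    real (time X) \<le> (\<Sum>v\<in>verts G. (estimate X v - residual X v) / (\<alpha> * (b * \<epsilon>r))
        * (1 + real (card (in_nbrs G v)))) + real (expansion_cost G \<epsilon>r X)"

section \<open>The invariant of the reverse loop and the average reverse time\<close>

context fin_digraph
begin

context
  fixes \<alpha> \<epsilon>r b :: real
  assumes \<alpha>: "\<alpha> \<in> {0<..<1}" and \<epsilon>r: "\<epsilon>r > 0" and b: "b \<in> {0<..<1}"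
begin

lemma frontier_inv_init:
  assumes "t \<in> verts G"
  shows "frontier_inv G \<alpha> \<epsilon>r b t (frontier_init \<alpha> t)"
proof -
  have "(\<Sum>w\<in>verts G. ppr G \<alpha> v w * residual (frontier_init \<alpha> t) w) = ppr G \<alpha> v t * \<alpha>" for v
    using assms by (simp add: frontier_init_def if_distrib[of "\<lambda>x. _ * x"] cong: if_cong)
  then show ?thesis
    using \<alpha> by (simp add: frontier_inv_def) (simp add: frontier_init_def)
qed

text \<open>What \<open>w\<close> loses reappears at its in-neighbours in the proportions of
  \<open>ppr_unfold\<close>, so the potential cannot increase. As the residual of \<open>w\<close>
  exceeds the threshold, the growth of its removed total pays for the push.\<close>

lemma frontier_inv_push:
  assumes inv: "frontier_inv G \<alpha> \<epsilon>r b t X" and w: "w \<in> verts G"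
    and large: "residual X w > \<alpha> * (b * \<epsilon>r)" and us: "distinct us" "set us = in_nbrs G w"
  shows "frontier_inv G \<alpha> \<epsilon>r b t (push G \<alpha> \<epsilon>r w us X)"
proof -
  define Y where "Y = fold (visit G \<alpha> \<epsilon>r w) us X"
  define Z where "Z = push G \<alpha> \<epsilon>r w us X"
  define a where "a = (if w \<in> set us then (1 - \<alpha>) / real (out_degree G w) else 0)"
  define r where "r = residual X w"
  have Z: "residual Z = (residual Y)(w := 0)" "estimate Z = estimate Y" "time Z = time Y + 1"
    "frontier Z = frontier Y"
    by (simp_all add: Z_def push_def Y_def Let_def)
  have nonneg: "\<And>v. 0 \<le> residual X v" and settled: "\<And>v. residual X v \<le> estimate X v"
    and pot: "\<And>v. v \<in> verts G \<Longrightarrow> estimate X v - residual X v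
      + (\<Sum>w\<in>verts G. ppr G \<alpha> v w * residual X w) / \<alpha> \<le> ppr G \<alpha> v t"
    and tm: "real (time X) \<le> (\<Sum>v\<in>verts G. (estimate X v - residual X v) / (\<alpha> * (b * \<epsilon>r))
        * (1 + real (card (in_nbrs G v)))) + real (expansion_cost G \<epsilon>r X)"
    using inv by (auto simp: frontier_inv_def)
  have usv: "set us \<subseteq> verts G" using us(2) in_nbrs_subset by simp
  note F = fold_visit[OF \<alpha> nonneg us(1) usv, where w = w and \<epsilon>r = \<epsilon>r, folded Y_def a_def]
  have a0: "a \<ge> 0" using \<alpha> by (simp add: a_def)
  have r0: "r \<ge> 0" using nonneg by (simp add: r_def)
  have thr: "\<alpha> * (b * \<epsilon>r) > 0" using \<alpha> b \<epsilon>r by simp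
  \<comment> \<open>A visit raises estimate and residual alike; only the final reset of
    \<open>w\<close> changes the difference, by its residual \<open>r * (1 + a)\<close> including
    the self-loop share.\<close>
  have settled_Z: "estimate Z v - residual Z v
      = estimate X v - residual X v + of_bool (v = w) * (r * (1 + a))" for v
    using F(2)[of v] F(1) by (auto simp: Z r_def)
  have Z1: "0 \<le> residual Z v \<and> residual Z v \<le> estimate Z v" for v
  proof
    show "0 \<le> residual Z v" using F(3)[of v] nonneg[of v] by (simp add: Z)
    have "0 \<le> estimate Z v - residual Z v"
      unfolding settled_Z using settled[of v] r0 a0 by auto
    then show "residual Z v \<le> estimate Z v" by simp
  qed
  have Z2: "estimate Z v - residual Z v + (\<Sum>x\<in>verts G. ppr G \<alpha> v x * residual Z x) / \<alpha>
      \<le> ppr G \<alpha> v t" if v: "v \<in> verts G" for v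
  proof -
    define p where "p = ppr G \<alpha> v w"
    have p0: "p \<ge> 0" using ppr_nonneg[OF \<alpha> w] by (simp add: p_def)
    let ?c = "\<lambda>x. (1 - \<alpha>) / real (out_degree G x)"
    have "(\<Sum>x\<in>verts G. ppr G \<alpha> v x * residual Z x)
        = (\<Sum>x\<in>verts G - {w}. ppr G \<alpha> v x * residual Z x)"
      using w by (subst sum.remove[of _ w]) (auto simp: Z)
    also have "\<dots> \<le> (\<Sum>x\<in>verts G - {w}. ppr G \<alpha> v x * residual X x
        + of_bool (x \<in> in_nbrs G w) * (r * (1 + a) * (ppr G \<alpha> v x * ?c x)))"
    proof (rule sum_mono)
      fix x assume x: "x \<in> verts G - {w}"
      then have "ppr G \<alpha> v x * residual Z x \<le> ppr G \<alpha> v x * (residual X x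
          + of_bool (x \<in> in_nbrs G w) * (r * (1 + a) * ?c x))"
        using F(4)[of x] us(2) ppr_nonneg[OF \<alpha>, of x v]
        by (intro mult_left_mono) (auto simp: Z r_def)
      then show "ppr G \<alpha> v x * residual Z x \<le> ppr G \<alpha> v x * residual X x
        + of_bool (x \<in> in_nbrs G w) * (r * (1 + a) * (ppr G \<alpha> v x * ?c x))"
        by (simp add: algebra_simps)
    qed
    also have "\<dots> = (\<Sum>x\<in>verts G - {w}. ppr G \<alpha> v x * residual X x)
        + (\<Sum>x\<in>in_nbrs G w - {w}. r * (1 + a) * (ppr G \<alpha> v x * ?c x))"
      using in_nbrs_subset[of w] unfolding sum.distrib
      by (intro arg_cong2[where f="(+)"] refl sum.mono_neutral_cong_right) auto
    also have "(\<Sum>x\<in>verts G - {w}. ppr G \<alpha> v x * residual X x)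
        = (\<Sum>x\<in>verts G. ppr G \<alpha> v x * residual X x) - p * r"
      using w by (simp add: sum.remove[of _ w] p_def r_def)
    \<comment> \<open>This is \<open>ppr_unfold\<close> at \<open>w\<close> without the self-loop
      term \<open>a * p\<close>: the share that \<open>w\<close> sends to itself is erased by the
      reset.\<close>
    also have "(\<Sum>x\<in>in_nbrs G w - {w}. r * (1 + a) * (ppr G \<alpha> v x * ?c x))
        = r * (1 + a) * (p - \<alpha> * of_bool (v = w) - a * p)"
    proof -
      have "(\<Sum>x\<in>in_nbrs G w. ppr G \<alpha> v x * ?c x)
          = (\<Sum>x\<in>in_nbrs G w - {w}. ppr G \<alpha> v x * ?c x) + a * p"
        by (cases "w \<in> in_nbrs G w") (auto simp: sum.remove[of _ w] a_def us(2) p_def)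
      then have "(\<Sum>x\<in>in_nbrs G w - {w}. ppr G \<alpha> v x * ?c x) = p - \<alpha> * of_bool (v = w) - a * p"
        using ppr_unfold[OF \<alpha> w, of v] by (simp add: p_def)
      then show ?thesis by (simp only: sum_distrib_left[symmetric])
    qed
    finally have "(\<Sum>x\<in>verts G. ppr G \<alpha> v x * residual Z x)
        \<le> (\<Sum>x\<in>verts G. ppr G \<alpha> v x * residual X x) - p * r
          + r * (1 + a) * (p - \<alpha> * of_bool (v = w) - a * p)" .
    \<comment> \<open>Since \<open>(1 + a) * (1 - a) = 1 - a\<^sup>2\<close>, a self-loop costs the
      potential \<open>a\<^sup>2 * p * r\<close>, a nonnegative loss dropped next.\<close>
    also have "\<dots> = (\<Sum>x\<in>verts G. ppr G \<alpha> v x * residual X x)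
        - \<alpha> * (of_bool (v = w) * (r * (1 + a))) - a\<^sup>2 * p * r"
      by (simp add: algebra_simps power2_eq_square)
    also have "\<dots> \<le> (\<Sum>x\<in>verts G. ppr G \<alpha> v x * residual X x)
        - \<alpha> * (of_bool (v = w) * (r * (1 + a)))"
      using p0 r0 by simp
    finally have "(\<Sum>x\<in>verts G. ppr G \<alpha> v x * residual Z x) / \<alpha>
        \<le> (\<Sum>x\<in>verts G. ppr G \<alpha> v x * residual X x) / \<alpha> - of_bool (v = w) * (r * (1 + a))"
      using \<alpha> by (simp add: field_simps)
    then show ?thesis using pot[OF v] settled_Z[of v] by linarith
  qed
  have Z3: "real (time Z) \<le> (\<Sum>v\<in>verts G. (estimate Z v - residual Z v) / (\<alpha> * (b * \<epsilon>r))
        * (1 + real (card (in_nbrs G v)))) + real (expansion_cost G \<epsilon>r Z)"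
  proof -
    define k where "k v = 1 + real (card (in_nbrs G v))" for v
    define q where "q = r * (1 + a) / (\<alpha> * (b * \<epsilon>r))"
    define S where "S V = (\<Sum>v\<in>verts G. (estimate V v - residual V v) / (\<alpha> * (b * \<epsilon>r)) * k v)"
      for V :: "'a frontier_state"
    have "length us = card (in_nbrs G w)" using distinct_card[OF us(1)] us(2) by simp
    moreover have "expansion_cost G \<epsilon>r Z = expansion_cost G \<epsilon>r Y"
      by (simp add: expansion_cost_def expanded_def Z)
    ultimately have "real (time Z) \<le> real (time X) + k w + real (expansion_cost G \<epsilon>r Z)
        - real (expansion_cost G \<epsilon>r X)"
      using F(5) by (simp add: Z(3) k_def)
    moreover have "S Z = S X + q * k w"
    proof -
      have "S Z = S X + (\<Sum>v\<in>verts G. of_bool (v = w) * (q * k v))"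
        unfolding S_def q_def settled_Z sum.distrib[symmetric] add_divide_distrib
        by (intro sum.cong refl) (simp add: distrib_right)
      also have "(\<Sum>v\<in>verts G. of_bool (v = w) * (q * k v)) = q * k w"
        using w by (subst sum.remove[of _ w]) (auto intro: sum.neutral)
      finally show ?thesis .
    qed
    \<comment> \<open>Apart from expansions a push of \<open>w\<close> costs \<open>k w\<close>;
      here the increase of \<open>S\<close> is seen to cover it.\<close>
    moreover have "1 * k w \<le> q * k w"
    proof (rule mult_right_mono)
      have "\<alpha> * (b * \<epsilon>r) \<le> r * 1" using large by (simp add: r_def)
      also have "\<dots> \<le> r * (1 + a)" using r0 a0 by (intro mult_left_mono) auto
      finally show "1 \<le> q" using thr by (simp add: q_def pos_le_divide_eq)
    qed (simp add: k_def)
    moreover have "real (time X) \<le> S X + real (expansion_cost G \<epsilon>r X)"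
      using tm by (simp add: S_def k_def)
    ultimately have "real (time Z) \<le> S Z + real (expansion_cost G \<epsilon>r Z)" by linarith
    then show ?thesis by (simp add: S_def k_def)
  qed
  show ?thesis
    using Z1 Z2 Z3 unfolding frontier_inv_def Z_def[symmetric] by blast
qed

lemma frontier_inv_reaches:
  assumes "t \<in> verts G" "frontier_reaches G \<alpha> \<epsilon>r b t X"
  shows "frontier_inv G \<alpha> \<epsilon>r b t X"
  using assms(2) unfolding frontier_reaches_def
proof (induction rule: rtranclp_induct)
  case base
  show ?case by (rule frontier_inv_init[OF assms(1)])
next
  case (step Y Z)
  then show ?case by (auto simp: frontier_step_def intro: frontier_inv_push)
qed

text \<open>Both removed residual and estimate at \<open>v\<close> are at most
  \<open>ppr G \<alpha> v t\<close>. Pushes account for one plus the in-neighbours and expansion for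
  the in-neighbours once more, whence the factor 2.\<close>

lemma frontier_inv_time:
  assumes inv: "frontier_inv G \<alpha> \<epsilon>r b t X" and t: "t \<in> verts G"
  shows "real (time X)
    \<le> (\<Sum>v\<in>verts G. (1 + 2 * real (card (in_nbrs G v))) * ppr G \<alpha> v t) / (\<alpha> * b * \<epsilon>r)"
proof -
  let ?k = "\<lambda>v. real (card (in_nbrs G v))" and ?\<theta> = "\<alpha> * (b * \<epsilon>r)"
  have nonneg: "\<And>v. 0 \<le> residual X v"
    and pot: "\<And>v. v \<in> verts G \<Longrightarrow> estimate X v - residual X v
      + (\<Sum>w\<in>verts G. ppr G \<alpha> v w * residual X w) / \<alpha> \<le> ppr G \<alpha> v t"
    and tm: "real (time X) \<le> (\<Sum>v\<in>verts G. (estimate X v - residual X v) / ?\<theta> * (1 + ?k v))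
        + real (expansion_cost G \<epsilon>r X)"
    using inv by (auto simp: frontier_inv_def)
  have thr: "?\<theta> > 0" using \<alpha> b \<epsilon>r by simp
  \<comment> \<open>The push threshold lies below \<open>\<epsilon>r\<close>, so expansion costs fit
    over the same denominator as push costs.\<close>
  have "\<alpha> * b \<le> 1" using \<alpha> b by (intro mult_le_one) auto
  then have thr': "?\<theta> \<le> \<epsilon>r"
    using \<epsilon>r mult_right_mono[of "\<alpha> * b" 1 \<epsilon>r] by (simp add: mult.assoc)
  have est: "estimate X v \<le> ppr G \<alpha> v t" if v: "v \<in> verts G" for v
  proof -
    have "\<alpha> * residual X v \<le> ppr G \<alpha> v v * residual X v"
      using ppr_self_ge[OF \<alpha> v] nonneg by (intro mult_right_mono)
    also have "\<dots> \<le> (\<Sum>w\<in>verts G. ppr G \<alpha> v w * residual X w)"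
      using v by (intro member_le_sum) (auto intro!: mult_nonneg_nonneg ppr_nonneg[OF \<alpha>] nonneg)
    finally have "residual X v \<le> (\<Sum>w\<in>verts G. ppr G \<alpha> v w * residual X w) / \<alpha>"
      using \<alpha> by (simp add: field_simps)
    with pot[OF v] show ?thesis by linarith
  qed
  have p0: "ppr G \<alpha> v t \<ge> 0" for v by (rule ppr_nonneg[OF \<alpha> t])
  have "real (expansion_cost G \<epsilon>r X) = (\<Sum>v\<in>expanded G \<epsilon>r X. ?k v * 1)"
    by (simp add: expansion_cost_def)
  also have "\<dots> \<le> (\<Sum>v\<in>expanded G \<epsilon>r X. ?k v * (ppr G \<alpha> v t / ?\<theta>))"
  proof (intro sum_mono mult_left_mono)
    fix v assume "v \<in> expanded G \<epsilon>r X"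
    then have "?\<theta> \<le> ppr G \<alpha> v t" using est[of v] thr' by (auto simp: expanded_def)
    then show "1 \<le> ppr G \<alpha> v t / ?\<theta>" using thr by simp
  qed simp
  also have "\<dots> \<le> (\<Sum>v\<in>verts G. ?k v * (ppr G \<alpha> v t / ?\<theta>))"
    using p0 thr by (intro sum_mono2) (auto simp: expanded_def)
  finally have "real (expansion_cost G \<epsilon>r X) \<le> (\<Sum>v\<in>verts G. ?k v * (ppr G \<alpha> v t / ?\<theta>))" .
  moreover have "(\<Sum>v\<in>verts G. (estimate X v - residual X v) / ?\<theta> * (1 + ?k v))
      \<le> (\<Sum>v\<in>verts G. ppr G \<alpha> v t / ?\<theta> * (1 + ?k v))"
  proof (intro sum_mono mult_right_mono divide_right_mono)
    fix v assume "v \<in> verts G"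
    then show "estimate X v - residual X v \<le> ppr G \<alpha> v t" using est[of v] nonneg[of v] by simp
  qed (use thr in auto)
  moreover have "(\<Sum>v\<in>verts G. ppr G \<alpha> v t / ?\<theta> * (1 + ?k v))
      + (\<Sum>v\<in>verts G. ?k v * (ppr G \<alpha> v t / ?\<theta>))
      = (\<Sum>v\<in>verts G. (1 + 2 * ?k v) * ppr G \<alpha> v t) / (\<alpha> * b * \<epsilon>r)"
    unfolding sum.distrib[symmetric] sum_divide_distrib
    by (intro sum.cong refl) (simp add: add_divide_distrib algebra_simps)
  ultimately show ?thesis using tm by linarith
qed

text \<open>The bound holds in every reachable state, hence for the supremum. It is finite and each
  push takes time, so no run is infinite.\<close>

lemma reverse_time_le:
  assumes "t \<in> verts G"
  shows "reverse_time G \<alpha> \<epsilon>r b t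
    \<le> ennreal ((\<Sum>v\<in>verts G. (1 + 2 * real (card (in_nbrs G v))) * ppr G \<alpha> v t) / (\<alpha> * b * \<epsilon>r))"
  unfolding reverse_time_def
proof (rule SUP_least)
  fix X assume "X \<in> {X. frontier_reaches G \<alpha> \<epsilon>r b t X}"
  then have "frontier_inv G \<alpha> \<epsilon>r b t X" using frontier_inv_reaches[OF assms] by simp
  from frontier_inv_time[OF this assms]
  show "of_nat (time X)
    \<le> ennreal ((\<Sum>v\<in>verts G. (1 + 2 * real (card (in_nbrs G v))) * ppr G \<alpha> v t) / (\<alpha> * b * \<epsilon>r))"
    by (simp only: ennreal_of_nat_eq_real_of_nat ennreal_leI)
qed

lemma avg_reverse_time_le:
  assumes ne: "verts G \<noteq> {}" and deg: "\<forall>v\<in>verts G. out_degree G v \<ge> 1"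
  shows "avg_reverse_time G \<alpha> \<epsilon>r b \<le> ennreal (3 * (avg_degree G / (\<alpha> * b * \<epsilon>r)))"
proof -
  let ?V = "verts G" and ?k = "\<lambda>v. 1 + 2 * real (card (in_nbrs G v))"
  have card: "card ?V > 0" using ne by (simp add: card_gt_0_iff)
  have thr: "\<alpha> * b * \<epsilon>r > 0" using \<alpha> b \<epsilon>r by simp
  have p0: "t \<in> ?V \<Longrightarrow> ppr G \<alpha> v t \<ge> 0" for v t by (rule ppr_nonneg[OF \<alpha>])
  define g where "g t = (\<Sum>v\<in>?V. ?k v * ppr G \<alpha> v t) / (\<alpha> * b * \<epsilon>r)" for t
  have g0: "g t \<ge> 0" if "t \<in> ?V" for t
    unfolding g_def using p0[OF that]
    by (intro divide_nonneg_pos[OF _ thr] sum_nonneg mult_nonneg_nonneg) auto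
  have "avg_reverse_time G \<alpha> \<epsilon>r b
      = (\<Sum>x\<in>?V \<times> ?V. reverse_time G \<alpha> \<epsilon>r b (snd x)) / card (?V \<times> ?V)"
    using ne by (simp add: avg_reverse_time_def nn_integral_pmf_of_set case_prod_unfold)
  also have "\<dots> \<le> (\<Sum>x\<in>?V \<times> ?V. ennreal (g (snd x))) / card (?V \<times> ?V)"
    unfolding g_def by (intro divide_right_mono_ennreal sum_mono reverse_time_le) auto
  also have "\<dots> = ennreal (\<Sum>x\<in>?V \<times> ?V. g (snd x)) / ennreal (card (?V \<times> ?V))"
    using g0 by (subst sum_ennreal) (auto simp: ennreal_of_nat_eq_real_of_nat)
  also have "\<dots> = ennreal ((\<Sum>x\<in>?V \<times> ?V. g (snd x)) / card (?V \<times> ?V))"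
    using card g0 by (intro divide_ennreal sum_nonneg) auto
  \<comment> \<open>The source does not affect the reverse phase, so it contributes a factor
    \<open>card ?V\<close> that cancels.\<close>
  also have "(\<Sum>x\<in>?V \<times> ?V. g (snd x)) = card ?V * (\<Sum>t\<in>?V. g t)"
    by (simp add: case_prod_unfold flip: sum.cartesian_product[of "\<lambda>s t. g t", unfolded case_prod_unfold])
  also have "card ?V * (\<Sum>t\<in>?V. g t) / card (?V \<times> ?V) = (\<Sum>t\<in>?V. g t) / card ?V"
    using card by (simp add: card_cartesian_product)
  also have "\<dots> \<le> ennreal (3 * (avg_degree G / (\<alpha> * b * \<epsilon>r)))"
  proof (rule ennreal_leI)
    \<comment> \<open>With the sum over targets innermost, \<open>sum_ppr_le\<close> removes
      PageRank and leaves a degree sum.\<close>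
    have "(\<Sum>t\<in>?V. \<Sum>v\<in>?V. ?k v * ppr G \<alpha> v t) = (\<Sum>v\<in>?V. ?k v * (\<Sum>t\<in>?V. ppr G \<alpha> v t))"
      by (subst sum.swap) (simp add: sum_distrib_left)
    also have "\<dots> \<le> (\<Sum>v\<in>?V. ?k v * 1)"
      by (intro sum_mono mult_left_mono sum_ppr_le[OF \<alpha>]) auto
    also have "\<dots> \<le> (\<Sum>v\<in>?V. 1 + 2 * real (in_degree G v))"
      using card_in_nbrs_le by (intro sum_mono) simp
    also have "\<dots> = real (card ?V) + 2 * real (card (arcs G))"
      by (simp add: sum.distrib sum_distrib_left[symmetric] sum_in_degree of_nat_sum[symmetric] del: of_nat_sum)
    also have "\<dots> = real (card ?V) * (1 + 2 * avg_degree G)"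
      using card ne by (simp add: avg_degree_def field_simps)
    also have "\<dots> \<le> real (card ?V) * (3 * avg_degree G)"
      using avg_degree_ge_1[OF ne deg] by (intro mult_left_mono) auto
    finally have "(\<Sum>t\<in>?V. \<Sum>v\<in>?V. ?k v * ppr G \<alpha> v t) / (\<alpha> * b * \<epsilon>r) / card ?V
        \<le> real (card ?V) * (3 * avg_degree G) / (\<alpha> * b * \<epsilon>r) / card ?V"
      using thr by (intro divide_right_mono) auto
    also have "\<dots> = 3 * (avg_degree G / (\<alpha> * b * \<epsilon>r))"
      using card ne by simp
    finally show "(\<Sum>t\<in>?V. g t) / card ?V \<le> 3 * (avg_degree G / (\<alpha> * b * \<epsilon>r))"
      by (simp only: g_def sum_divide_distrib)
  qed
  finally show ?thesis .
qed

end

end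


section \<open>Forward phase\<close>

text \<open>Generalises \<open>expected_work\<close> to arbitrary result types, so that costs can be
  evaluated along the binds of a program.\<close>

definition expected_cost :: "('x \<Rightarrow> ennreal) \<Rightarrow> 'x spmf \<Rightarrow> ennreal" where
  "expected_cost f p = (\<integral>\<^sup>+ x. (case x of None \<Rightarrow> \<infinity> | Some y \<Rightarrow> f y) \<partial>measure_pmf p)"

lemma expected_work_conv: "expected_work p = expected_cost of_nat p"
  by (simp add: expected_work_def expected_cost_def)

lemma expected_cost_return [simp]: "expected_cost f (return_spmf x) = f x"
  by (simp add: expected_cost_def)

text \<open>The law of total expectation. Failure of \<open>p\<close> makes the whole bind fail, and
  both sides value it as infinity.\<close>

lemma expected_cost_bind [simp]:
  "expected_cost f (bind_spmf p q) = expected_cost (\<lambda>y. expected_cost f (q y)) p"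
  unfolding expected_cost_def bind_spmf_def
  by (auto intro!: nn_integral_cong split: option.split)

lemma expected_cost_bind_pmf [simp]:
  "expected_cost f (bind_pmf p q) = (\<integral>\<^sup>+ x. expected_cost f (q x) \<partial>measure_pmf p)"
  by (simp add: expected_cost_def)

lemma expected_cost_mono: "(\<And>x. f x \<le> g x) \<Longrightarrow> expected_cost f p \<le> expected_cost g p"
  unfolding expected_cost_def by (intro nn_integral_mono) (auto split: option.split)

lemma expected_cost_add_const: "expected_cost (\<lambda>x. a + f x) p = a + expected_cost f p"
proof -
  have "expected_cost (\<lambda>x. a + f x) p
      = (\<integral>\<^sup>+ x. a + (case x of None \<Rightarrow> \<infinity> | Some y \<Rightarrow> f y) \<partial>measure_pmf p)"
    unfolding expected_cost_def by (intro nn_integral_cong) (auto split: option.split)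
  then show ?thesis by (simp add: nn_integral_add expected_cost_def)
qed

lemma expected_cost_add_const_right: "expected_cost (\<lambda>x. f x + a) p = expected_cost f p + a"
  using expected_cost_add_const[of a f p] by (simp add: add.commute)

text \<open>
  The recursion alone gives only \<open>m \<le> 1 + (1 - p) * m\<close> for the expected number of samples,
  which infinity satisfies too. Truncating the number of samples at \<open>N\<close>, with value \<open>N\<close> for
  non-termination, makes \<open>m\<close> finite; then \<open>N\<close> tends to infinity.
\<close>

lemma expected_cost_sample_avoiding:
  assumes A: "finite A" and ne: "A - T \<noteq> {}"
  shows "expected_cost (\<lambda>(v, k). of_nat k) (sample_avoiding A T)
    \<le> ennreal (real (card A) / real (card (A - T)))"
proof -
  define h :: "nat \<Rightarrow> ('a \<times> nat) option \<Rightarrow> ennreal" where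
    "h N x = (case x of None \<Rightarrow> of_nat N | Some (v, k) \<Rightarrow> of_nat (min k N))" for N x
  define m where "m N = (\<integral>\<^sup>+ x. h N x \<partial>measure_pmf (sample_avoiding A T))" for N
  \<comment> \<open>The retry branch: the rejected sample is counted on top of a fresh run.\<close>
  define R where "R = bind_spmf (sample_avoiding A T) (\<lambda>(v', k). return_spmf (v', k + 1))"
  have unfold: "sample_avoiding A T
      = bind_spmf (spmf_of_set A) (\<lambda>v. if v \<notin> T then return_spmf (v, 1) else R)"
    unfolding R_def by (rule sample_avoiding.simps)
  have A_ne: "A \<noteq> {}" using ne by auto
  have card: "card (A - T) > 0" "card A > 0" using ne A by (auto simp: card_gt_0_iff)
  have bound: "m N \<le> ennreal (real (card A) / real (card (A - T)))" for N
  proof -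
    have "m N \<le> (\<integral>\<^sup>+ x. of_nat N \<partial>measure_pmf (sample_avoiding A T))"
      unfolding m_def by (intro nn_integral_mono)
        (auto simp: h_def split: option.split)
    then have "m N \<le> of_nat N" by simp
    then have fin: "m N < \<top>"
      by (rule order_le_less_trans) (simp add: of_nat_less_top)
    define M where "M = enn2real (m N)"
    have M: "m N = ennreal M" "M \<ge> 0" using fin by (simp_all add: M_def)
    \<comment> \<open>Only an inequality, since truncation gives
      \<open>min (k + 1) N \<le> 1 + min k N\<close>; for failure it reads
      \<open>N \<le> 1 + N\<close>.\<close>
    have rec: "(\<integral>\<^sup>+ x. h N x \<partial>measure_pmf R) \<le> 1 + m N"
    proof -
      have "(\<integral>\<^sup>+ x. h N x \<partial>measure_pmf R) \<le> (\<integral>\<^sup>+ x. 1 + h N x \<partial>measure_pmf (sample_avoiding A T))"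
        unfolding R_def bind_spmf_def nn_integral_bind_pmf
      proof (rule nn_integral_mono)
        fix x :: "('a \<times> nat) option"
        show "(\<integral>\<^sup>+ y. h N y \<partial>measure_pmf (case x of None \<Rightarrow> return_pmf None
            | Some a \<Rightarrow> (case a of (v', k) \<Rightarrow> return_spmf (v', k + 1)))) \<le> 1 + h N x"
        proof (cases x)
          case None
          then show ?thesis by (simp add: h_def)
        next
          case (Some y)
          obtain v k where y: "y = (v, k)" by (cases y)
          have "h N (Some (v, k + 1)) \<le> of_nat (1 + min k N)"
            unfolding h_def option.case prod.case by (rule of_nat_mono) simp
          then show ?thesis by (simp only: Some y h_def) (simp add: of_nat_add)
        qed
      qed
      then show ?thesis by (simp add: nn_integral_add m_def)
    qed
    have "m N = (\<Sum>v\<in>A. if v \<notin> T then of_nat (min 1 N) else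
        (\<integral>\<^sup>+ x. h N x \<partial>measure_pmf R)) / card A"
    proof -
      have "m N = (\<integral>\<^sup>+ v. \<integral>\<^sup>+ x. h N x \<partial>measure_pmf (if v \<notin> T then return_spmf (v, 1) else R)
          \<partial>measure_pmf (pmf_of_set A))"
        unfolding m_def unfold spmf_of_pmf_pmf_of_set[OF A A_ne, symmetric] bind_spmf_of_pmf
        by (rule nn_integral_bind_pmf)
      also have "\<dots> = (\<Sum>v\<in>A. \<integral>\<^sup>+ x. h N x
          \<partial>measure_pmf (if v \<notin> T then return_spmf (v, 1) else R)) / card A"
        by (rule nn_integral_pmf_of_set[OF A_ne A])
      also have "(\<Sum>v\<in>A. \<integral>\<^sup>+ x. h N x \<partial>measure_pmf (if v \<notin> T then return_spmf (v, 1) else R))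
          = (\<Sum>v\<in>A. if v \<notin> T then of_nat (min 1 N) else (\<integral>\<^sup>+ x. h N x \<partial>measure_pmf R))"
        by (intro sum.cong refl) (simp add: h_def del: of_nat_min)
      finally show ?thesis .
    qed
    also have "\<dots> \<le> (\<Sum>v\<in>A. if v \<notin> T then 1 else 1 + m N) / card A"
    proof (intro divide_right_mono_ennreal sum_mono)
      fix v
      have "(of_nat (min 1 N) :: ennreal) \<le> of_nat 1" by (rule of_nat_mono) simp
      then show "(if v \<notin> T then of_nat (min 1 N) else
        (\<integral>\<^sup>+ x. h N x \<partial>measure_pmf R))
        \<le> (if v \<notin> T then 1 else 1 + m N)"
        using rec by simp
    qed
    also have "\<dots> = (\<Sum>v\<in>A. ennreal (1 + of_bool (v \<in> T) * M)) / card A"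
      by (intro arg_cong2[where f="(/)"] sum.cong) (auto simp: M)
    also have "\<dots> = ennreal ((\<Sum>v\<in>A. 1 + of_bool (v \<in> T) * M) / card A)"
      using card M(2)
      by (subst sum_ennreal) (auto simp: ennreal_of_nat_eq_real_of_nat intro!: divide_ennreal sum_nonneg)
    also have "(\<Sum>v\<in>A. 1 + of_bool (v \<in> T) * M) = card A + card (A \<inter> T) * M"
      using A by (simp add: sum.distrib sum_distrib_right[symmetric])
    \<comment> \<open>Finiteness of \<open>M\<close> pays off here: the inequality is one between
      reals and can be solved for \<open>M\<close>.\<close>
    finally have "M \<le> (card A + card (A \<inter> T) * M) / card A"
      using M by (simp add: ennreal_le_iff)
    then have "card A * M \<le> card A + card (A \<inter> T) * M"
      using card by (simp add: field_simps)
    moreover have "real (card A) = card (A - T) + card (A \<inter> T)"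
      using A card_Diff_subset_Int[of A T] card_mono[of A "A \<inter> T"] by (simp add: finite_Int)
    ultimately have "card (A - T) * M \<le> card A" by (simp add: algebra_simps)
    then have "M \<le> real (card A) / real (card (A - T))" using card by (simp add: field_simps)
    then show ?thesis by (simp add: M ennreal_leI)
  qed
  \<comment> \<open>The truncations increase to the number of samples, and to infinity on failure,
    so monotone convergence applies.\<close>
  have "expected_cost (\<lambda>(v, k). of_nat k) (sample_avoiding A T)
      = (\<integral>\<^sup>+ x. (SUP N. h N x) \<partial>measure_pmf (sample_avoiding A T))"
    unfolding expected_cost_def
  proof (rule nn_integral_cong)
    fix x :: "('a \<times> nat) option"
    show "(case x of None \<Rightarrow> \<infinity> | Some y \<Rightarrow> case y of (v, k) \<Rightarrow> of_nat k) = (SUP N. h N x)"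
    proof (cases x)
      case None
      then show ?thesis by (simp add: h_def ennreal_SUP_of_nat_eq_top)
    next
      case (Some y)
      obtain v k where y: "y = (v, k)" by (cases y)
      have "(SUP N. of_nat (min k N)) = (of_nat k :: ennreal)"
        by (intro antisym SUP_least SUP_upper2[of k]) auto
      then show ?thesis by (simp add: Some y h_def)
    qed
  qed
  also have "\<dots> = (SUP N. m N)"
    unfolding m_def
    by (rule nn_integral_monotone_convergence_SUP)
      (auto simp: h_def incseq_def le_fun_def intro: of_nat_mono split: option.split)
  also have "\<dots> \<le> ennreal (real (card A) / real (card (A - T)))"
    by (intro SUP_least bound)
  finally show ?thesis .
qed

text \<open>By induction on the steps left: each costs 1 for the move and on average at most
  \<open>1 / pm\<close> samples, as the acceptance probability is at least
  \<open>p_avoid G T u\<close>.\<close>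

lemma (in fin_digraph) expected_cost_avoiding_walk:
  assumes pm: "pm > 0" and b: "b \<le> real L"
  shows "expected_cost (\<lambda>(vs, x). of_nat x) (avoiding_walk G T pm b u j)
    \<le> ennreal (real (L - j) * (1 + 1 / pm))"
proof (induction "L - j" arbitrary: u j)
  case 0
  \<comment> \<open>Truncated subtraction: \<open>L - j = 0\<close> means \<open>j \<ge> L\<close>,
    so the walk stops at once.\<close>
  then have "real j \<ge> b" using b by simp
  then show ?case by (subst avoiding_walk.simps) simp
next
  case (Suc d)
  let ?B = "real d * (1 + 1 / pm)" and ?A = "out_nbrs G u"
  show ?case
  proof (cases "p_avoid G T u < pm \<or> real j \<ge> b")
    case True
    then show ?thesis by (subst avoiding_walk.simps) simp
  next
    case False
    have pos: "p_avoid G T u \<ge> pm" using False by simp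
    then have "p_avoid G T u > 0" using pm by simp
    \<comment> \<open>If either cardinality were 0, the quotient \<open>p_avoid\<close> would be 0,
      in the second case by the convention for division by zero.\<close>
    then have ne: "card (?A - T) \<noteq> 0" and deg: "out_degree G u \<noteq> 0"
      by (metis less_irrefl p_avoid_def of_nat_0 div_0, metis less_irrefl p_avoid_def of_nat_0 div_by_0)
    have IH: "expected_cost (\<lambda>(vs, x). of_nat x) (avoiding_walk G T pm b v (Suc j)) \<le> ennreal ?B" for v
    proof -
      have d: "d = L - Suc j" using Suc.hyps(2) by simp
      then show ?thesis using Suc.hyps(1)[OF d, of v] by simp
    qed
    have samples: "expected_cost (\<lambda>(v, k). of_nat k) (sample_avoiding ?A T) \<le> ennreal (1 / pm)"
    proof -
      have "expected_cost (\<lambda>(v, k). of_nat k) (sample_avoiding ?A T)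
          \<le> ennreal (real (card ?A) / real (card (?A - T)))"
        using ne by (intro expected_cost_sample_avoiding) auto
      also have "\<dots> \<le> ennreal (1 / pm)"
      proof (rule ennreal_leI)
        have "pm * real (card ?A) \<le> pm * real (out_degree G u)"
          using card_out_nbrs_le[of u] pm by simp
        also have "\<dots> \<le> real (card (?A - T))" using pos deg by (simp add: p_avoid_def field_simps)
        finally show "real (card ?A) / real (card (?A - T)) \<le> 1 / pm"
          using ne pm by (subst pos_divide_le_eq) (auto simp: pos_le_divide_eq mult.commute card_gt_0_iff)
      qed
      finally show ?thesis .
    qed
    have "expected_cost (\<lambda>(vs, x). of_nat x) (avoiding_walk G T pm b u j)
        = expected_cost (\<lambda>(v, k). expected_cost (\<lambda>(vs, x). (1 + of_nat k) + of_nat x)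
            (avoiding_walk G T pm b v (Suc j))) (sample_avoiding ?A T)"
      using False by (subst avoiding_walk.simps)
        (auto simp: case_prod_unfold add_ac intro!: arg_cong2[where f=expected_cost] ext)
    also have "\<dots> \<le> expected_cost (\<lambda>(v, k). (1 + ennreal ?B) + of_nat k) (sample_avoiding ?A T)"
    proof (rule expected_cost_mono, clarify)
      fix v and k :: nat
      show "expected_cost (\<lambda>(vs, x). (1 + of_nat k) + of_nat x) (avoiding_walk G T pm b v (Suc j))
          \<le> (1 + ennreal ?B) + of_nat k"
        using IH[of v] expected_cost_add_const[of "1 + of_nat k" "\<lambda>(vs, x). of_nat x"
            "avoiding_walk G T pm b v (Suc j)"]
        by (simp add: case_prod_unfold add_ac add_left_mono)
    qed
    also have "\<dots> = (1 + ennreal ?B) + expected_cost (\<lambda>(v, k). of_nat k) (sample_avoiding ?A T)"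
      by (simp add: case_prod_unfold expected_cost_add_const)
    also have "\<dots> \<le> (1 + ennreal ?B) + ennreal (1 / pm)"
      by (intro add_left_mono samples)
    also have "\<dots> = ennreal (1 + ?B + 1 / pm)"
      using pm by (simp flip: ennreal_1 ennreal_plus)
    also have "1 + ?B + 1 / pm = real (L - j) * (1 + 1 / pm)"
      by (simp add: Suc.hyps(2)[symmetric] algebra_simps)
    finally show ?thesis .
  qed
qed

lemma nn_integral_geometric_pmf:
  assumes "\<alpha> \<in> {0<..<1}"
  shows "(\<integral>\<^sup>+ L. ennreal (real L) \<partial>measure_pmf (geometric_pmf \<alpha>)) = ennreal ((1 - \<alpha>) / \<alpha>)"
  using assms integrable_real_geometric_pmf[of \<alpha>] expectation_geometric_pmf[of \<alpha>]
  by (subst nn_integral_eq_integral) auto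

text \<open>Capping by \<open>lm\<close> only shortens a walk, so its expected work is bounded
  through the mean of \<open>L\<close>; the unit for drawing \<open>L\<close> is added per
  walk.\<close>

lemma (in fin_digraph) expected_work_forward_le:
  assumes \<alpha>: "\<alpha> \<in> {0<..<1}" and pm: "pm \<in> {0<..1}"
  shows "expected_work (forward_work G T \<alpha> pm lm s N) \<le> ennreal (real N * (2 / (\<alpha> * pm)))"
proof (induction N)
  case 0
  show ?case by (simp add: expected_work_conv)
next
  case (Suc N)
  let ?F = "expected_work (forward_work G T \<alpha> pm lm s N)"
  have "expected_work (forward_work G T \<alpha> pm lm s (Suc N))
      = (\<integral>\<^sup>+ L. (1 + ?F) + expected_cost (\<lambda>(vs, x). of_nat x)
          (avoiding_walk G T pm (min (real L) lm) s 0) \<partial>measure_pmf (geometric_pmf \<alpha>))"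
    by (simp add: expected_work_conv case_prod_unfold expected_cost_add_const
        expected_cost_add_const_right add_ac)
  also have "\<dots> \<le> (\<integral>\<^sup>+ L. (1 + ?F) + ennreal (1 + 1 / pm) * ennreal (real L) \<partial>measure_pmf (geometric_pmf \<alpha>))"
  proof (intro nn_integral_mono add_left_mono)
    fix L
    show "expected_cost (\<lambda>(vs, x). of_nat x) (avoiding_walk G T pm (min (real L) lm) s 0)
        \<le> ennreal (1 + 1 / pm) * ennreal (real L)"
      using expected_cost_avoiding_walk[of pm "min (real L) lm" L T s 0] pm
      by (simp add: ennreal_mult'[symmetric] mult.commute del: ennreal_plus)
  qed
  also have "\<dots> = 1 + ?F
      + ennreal (1 + 1 / pm) * (\<integral>\<^sup>+ L. ennreal (real L) \<partial>measure_pmf (geometric_pmf \<alpha>))"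
    by (simp add: nn_integral_add nn_integral_cmult del: ennreal_plus)
  also have "\<dots> = 1 + ?F + ennreal ((1 + 1 / pm) * ((1 - \<alpha>) / \<alpha>))"
    unfolding nn_integral_geometric_pmf[OF \<alpha>] using \<alpha> pm by (subst ennreal_mult') auto
  also have "\<dots> \<le> 1 + ennreal (real N * (2 / (\<alpha> * pm))) + ennreal ((1 + 1 / pm) * ((1 - \<alpha>) / \<alpha>))"
    using Suc by (intro add_mono) auto
  also have "\<dots> = ennreal (1 + real N * (2 / (\<alpha> * pm)) + (1 + 1 / pm) * ((1 - \<alpha>) / \<alpha>))"
    using pm \<alpha> by (simp flip: ennreal_1 ennreal_plus)
  also have "\<dots> \<le> ennreal (real (Suc N) * (2 / (\<alpha> * pm)))"
  proof (rule ennreal_leI)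
    \<comment> \<open>The left side equals \<open>pm + 1 - \<alpha>\<close>, so
      \<open>pm \<le> 1\<close> suffices; this is the source of the constant 2.\<close>
    have "\<alpha> * pm + (pm + 1) * (1 - \<alpha>) \<le> 2"
      using \<alpha> pm mult_nonneg_nonneg[of \<alpha> pm] by (simp add: algebra_simps)
    then have "(\<alpha> * pm + (pm + 1) * (1 - \<alpha>)) / (\<alpha> * pm) \<le> 2 / (\<alpha> * pm)"
      using \<alpha> pm by (intro divide_right_mono) auto
    moreover have "1 + (1 + 1 / pm) * ((1 - \<alpha>) / \<alpha>) = (\<alpha> * pm + (pm + 1) * (1 - \<alpha>)) / (\<alpha> * pm)"
      using \<alpha> pm by (simp add: divide_simps)
    ultimately have "1 + (1 + 1 / pm) * ((1 - \<alpha>) / \<alpha>) \<le> 2 / (\<alpha> * pm)" by simp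
    then show "1 + real N * (2 / (\<alpha> * pm)) + (1 + 1 / pm) * ((1 - \<alpha>) / \<alpha>) \<le> real (Suc N) * (2 / (\<alpha> * pm))"
      unfolding of_nat_Suc distrib_right[of 1] by linarith
  qed
  finally show ?case .
qed


section \<open>Parameters\<close>

lemma beta_in: "c \<in> {0<..<1} \<Longrightarrow> beta c \<in> {0<..<1}"
  by (auto simp: beta_def field_simps)

lemma inverse_p_min_le:
  assumes "c \<in> {0<..<1}"
  shows "1 / p_min c \<le> 6 / c"
  using assms beta_in[OF assms] by (auto simp: p_min_def field_simps)

lemma p_min_in:
  assumes "c \<in> {0<..<1}"
  shows "p_min c \<in> {0<..1}"
  using assms beta_in[OF assms] by (auto simp: p_min_def divide_simps)

text \<open>Both logarithms in the change of base are negative; inverting the arguments makes signs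
  evident and exposes the factor \<open>1 / ln (1 / (1 - \<alpha>))\<close>.\<close>

lemma l_max_eq:
  assumes "\<alpha> \<in> {0<..<1}" "c > 0" "\<delta> > 0"
  shows "l_max \<alpha> c \<delta> = ln (3 / (c * \<delta>)) / ln (1 / (1 - \<alpha>))"
  using assms by (simp add: l_max_def log_def ln_div ln_mult divide_simps)

lemma n_f_nonneg:
  assumes "\<delta> \<in> {0<..<1}" "\<alpha> \<in> {0<..<1}" "c \<in> {0<..<1}" "pf \<in> {0<..<1}" "\<epsilon>r > 0"
  shows "n_f \<alpha> c \<delta> pf \<epsilon>r \<ge> 0"
proof -
  have "c * \<delta> \<le> 1" using assms by (intro mult_le_one) auto
  then have "l_max \<alpha> c \<delta> \<ge> 0"
    using assms by (subst l_max_eq) (auto simp: field_simps intro!: divide_nonneg_nonneg)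
  moreover have "ln (2 / pf) \<ge> 0" using assms by (auto simp: field_simps)
  ultimately show ?thesis using assms by (auto simp: n_f_def eps_f_def)
qed

text \<open>Keeping \<open>x\<close> away from 1 makes \<open>ln (1 / x)\<close> bounded below, so
  additive constants such as \<open>ln 2\<close> and \<open>ln 3\<close> become multiples of
  it.\<close>

lemma const_le_mult_ln_inverse:
  fixes q x :: real
  assumes "q \<in> {0<..<1}" "x \<in> {0<..q}" "a \<ge> 0"
  shows "a \<le> a / ln (1 / q) * ln (1 / x)"
proof -
  have "0 < ln (1 / q)" "ln (1 / q) \<le> ln (1 / x)" using assms by (auto simp: field_simps)
  then show ?thesis using assms(3) mult_left_mono[of "ln (1 / q)" "ln (1 / x)" a] by (simp add: field_simps)
qed

text \<open>From \<open>\<delta> powr \<kappa> \<le> c\<close> follows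
  \<open>ln (1 / c) \<le> \<kappa> * ln (1 / \<delta>)\<close>, which removes \<open>c\<close> from
  the logarithm. The factor 270 is 45 from \<open>n_f\<close> times 6 from
  \<open>inverse_p_min_le\<close>.\<close>

lemma n_f_le:
  assumes q: "q \<in> {0<..<1}" and \<kappa>: "\<kappa> > 0"
    and "\<delta> \<in> {0<..<1}" "\<alpha> \<in> {0<..<1}" "c \<in> {0<..<1}" "pf \<in> {0<..<1}" "\<epsilon>r > 0"
    and "\<delta> \<le> q" "pf \<le> q" "\<delta> powr \<kappa> \<le> c"
  shows "n_f \<alpha> c \<delta> pf \<epsilon>r / (\<alpha> * p_min c)
    \<le> 270 * (ln 3 / ln (1 / q) + \<kappa> + 1) * (ln 2 / ln (1 / q) + 1)
      * (ln (1 / pf) * ln (1 / \<delta>) / (c ^ 3 * \<alpha> * eps_f \<delta> \<epsilon>r * ln (1 / (1 - \<alpha>))))"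
proof -
  let ?A = "ln 3 / ln (1 / q) + \<kappa> + 1" and ?B = "ln 2 / ln (1 / q) + 1"
  let ?E = "eps_f \<delta> \<epsilon>r" and ?l = "ln (1 / (1 - \<alpha>))"
  have pos: "c > 0" "\<alpha> > 0" "?E > 0" "?l > 0" "\<delta> > 0" "pf > 0" "p_min c > 0"
    using assms p_min_in[of c] by (auto simp: eps_f_def)
  have "\<kappa> * ln \<delta> = ln (\<delta> powr \<kappa>)" using pos by (simp add: ln_powr)
  also have "\<dots> \<le> ln c" using assms pos by (subst ln_le_cancel_iff) auto
  finally have "ln (3 / (c * \<delta>)) \<le> ln 3 + (\<kappa> + 1) * ln (1 / \<delta>)"
    using pos by (simp add: ln_div ln_mult algebra_simps)
  also have "\<dots> \<le> ?A * ln (1 / \<delta>)"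
    using const_le_mult_ln_inverse[of q \<delta> "ln 3"] assms by (simp add: algebra_simps)
  finally have l1: "ln (3 / (c * \<delta>)) \<le> ?A * ln (1 / \<delta>)" .
  have "ln (2 / pf) = ln 2 + ln (1 / pf)" using pos by (simp add: ln_div)
  also have "\<dots> \<le> ?B * ln (1 / pf)"
    using const_le_mult_ln_inverse[of q pf "ln 2"] assms by (simp add: algebra_simps)
  finally have l2: "ln (2 / pf) \<le> ?B * ln (1 / pf)" .
  have "c * \<delta> \<le> 1" using assms by (intro mult_le_one) auto
  then have l3: "ln (3 / (c * \<delta>)) \<ge> 0" using pos by (simp add: field_simps)
  have l4: "ln (2 / pf) \<ge> 0" using assms by (simp add: field_simps)
  have "n_f \<alpha> c \<delta> pf \<epsilon>r / (\<alpha> * p_min c)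
      = 45 * (ln (3 / (c * \<delta>)) * ln (2 / pf)) / (c\<^sup>2 * ?E * \<alpha> * ?l) * (1 / p_min c)"
    using assms pos by (simp add: n_f_def l_max_eq mult_ac)
  also have "\<dots> \<le> 45 * ((?A * ln (1 / \<delta>)) * (?B * ln (1 / pf))) / (c\<^sup>2 * ?E * \<alpha> * ?l) * (6 / c)"
    using l1 l2 l3 l4 pos inverse_p_min_le[of c] assms
    by (intro mult_mono divide_right_mono) (auto intro: order_trans)
  also have "\<dots> = 270 * ?A * ?B * (ln (1 / pf) * ln (1 / \<delta>) / (c ^ 3 * \<alpha> * ?E * ?l))"
    by (simp add: power2_eq_square power3_eq_cube mult_ac)
  finally show ?thesis .
qed

lemma (in fin_digraph) avg_forward_time_le:
  assumes "\<delta> \<in> {0<..<1}" "\<alpha> \<in> {0<..<1}" "c \<in> {0<..<1}" "pf \<in> {0<..<1}" "\<epsilon>r > 0"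
  shows "avg_forward_time G T \<alpha> c \<delta> pf \<epsilon>r s \<le> ennreal (2 * (n_f \<alpha> c \<delta> pf \<epsilon>r / (\<alpha> * p_min c)))"
proof -
  let ?n = "n_f \<alpha> c \<delta> pf \<epsilon>r" and ?k = "2 / (\<alpha> * p_min c)"
  have "avg_forward_time G T \<alpha> c \<delta> pf \<epsilon>r s \<le> ennreal (real (nat \<lfloor>?n\<rfloor>) * ?k)"
    unfolding avg_forward_time_def
    by (rule expected_work_forward_le[OF assms(2) p_min_in[OF assms(3)]])
  \<comment> \<open>Nonnegativity of \<open>n_f\<close> is needed because \<open>nat\<close> would
    otherwise round a negative floor up to 0.\<close>
  also have "\<dots> \<le> ennreal (?n * ?k)"
    using n_f_nonneg[OF assms] assms p_min_in[OF assms(3)]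
    by (intro ennreal_leI mult_right_mono) auto
  finally show ?thesis by (simp add: mult_ac)
qed

text \<open>The simplified rate needs a regime: as \<delta> or \<open>pf\<close> tends to 1 it
  vanishes while \<open>n_f\<close> does not, and as \<open>c\<close> tends to 0 for fixed \<delta>
  it misses a factor \<open>ln (1 / c)\<close>. The parameters \<open>q\<close> and \<kappa> exclude
  these cases.\<close>

theorem theorem7:
  shows
    "(\<exists>C>0. \<forall>(G :: ('a, 'b) pre_digraph) \<delta> \<alpha> c pf \<epsilon>r.
        fin_digraph G \<longrightarrow> nomulti_digraph G \<longrightarrow> verts G \<noteq> {} \<longrightarrow>
        (\<forall>v\<in>verts G. out_degree G v \<ge> 1) \<longrightarrow>
        \<delta> \<in> {0<..<1} \<longrightarrow> \<alpha> \<in> {0<..<1} \<longrightarrow> c \<in> {0<..<1} \<longrightarrow> pf \<in> {0<..<1} \<longrightarrow> \<epsilon>r > 0 \<longrightarrow>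
        avg_reverse_time G \<alpha> \<epsilon>r (beta c)
          \<le> ennreal (C * (avg_degree G / (\<alpha> * beta c * \<epsilon>r))) \<and>
        avg_degree G / (\<alpha> * beta c * \<epsilon>r) \<le> C * (avg_degree G / (c * \<alpha> * \<epsilon>r)) \<and>
        (\<forall>s\<in>verts G. \<forall>t\<in>verts G. \<forall>X. frontier_output G \<alpha> \<epsilon>r (beta c) t X \<longrightarrow>
          avg_forward_time G (target X) \<alpha> c \<delta> pf \<epsilon>r s
            \<le> ennreal (C * (n_f \<alpha> c \<delta> pf \<epsilon>r / (\<alpha> * p_min c)))))
     \<and>
     (\<forall>q\<in>{0<..<1::real}. \<forall>\<kappa>>0. \<exists>C>0. \<forall>\<delta> \<alpha> c pf \<epsilon>r :: real.
        \<delta> \<in> {0<..<1} \<longrightarrow> \<alpha> \<in> {0<..<1} \<longrightarrow> c \<in> {0<..<1} \<longrightarrow> pf \<in> {0<..<1} \<longrightarrow> \<epsilon>r > 0 \<longrightarrow>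
        \<delta> \<le> q \<longrightarrow> pf \<le> q \<longrightarrow> \<delta> powr \<kappa> \<le> c \<longrightarrow>
        n_f \<alpha> c \<delta> pf \<epsilon>r / (\<alpha> * p_min c)
          \<le> C * (ln (1 / pf) * ln (1 / \<delta>) /
                 (c ^ 3 * \<alpha> * eps_f \<delta> \<epsilon>r * ln (1 / (1 - \<alpha>)))))"
    (is "?bounds \<and> ?simplified")
proof
  show ?bounds
  \<comment> \<open>The constant 4 covers 3 for the reverse time, 2 for the forward time and
    \<open>1 / beta c = (3 + c) / c \<le> 4 / c\<close>.\<close>
  proof (intro exI[of _ 4] conjI allI impI ballI)
    fix G :: "('a, 'b) pre_digraph" and \<delta> \<alpha> c pf \<epsilon>r :: real
    assume "fin_digraph G" and ne: "verts G \<noteq> {}" and deg: "\<forall>v\<in>verts G. out_degree G v \<ge> 1"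
      and \<delta>: "\<delta> \<in> {0<..<1}" and \<alpha>: "\<alpha> \<in> {0<..<1}" and c: "c \<in> {0<..<1}" and pf: "pf \<in> {0<..<1}"
      and \<epsilon>r: "\<epsilon>r > 0"
    interpret fin_digraph G by fact
    have d: "avg_degree G \<ge> 1" by (rule avg_degree_ge_1[OF ne deg])
    have b: "beta c \<in> {0<..<1}" by (rule beta_in[OF c])
    have "avg_reverse_time G \<alpha> \<epsilon>r (beta c) \<le> ennreal (3 * (avg_degree G / (\<alpha> * beta c * \<epsilon>r)))"
      by (rule avg_reverse_time_le[OF \<alpha> \<epsilon>r b ne deg])
    also have "\<dots> \<le> ennreal (4 * (avg_degree G / (\<alpha> * beta c * \<epsilon>r)))"
      using d \<alpha> b \<epsilon>r by (intro ennreal_leI mult_right_mono) auto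
    finally show "avg_reverse_time G \<alpha> \<epsilon>r (beta c)
        \<le> ennreal (4 * (avg_degree G / (\<alpha> * beta c * \<epsilon>r)))" .
    have "1 / beta c \<le> 4 / c" using c by (auto simp: beta_def field_simps)
    then have "avg_degree G / (\<alpha> * \<epsilon>r) * (1 / beta c) \<le> avg_degree G / (\<alpha> * \<epsilon>r) * (4 / c)"
      using d \<alpha> \<epsilon>r by (intro mult_left_mono) auto
    then show "avg_degree G / (\<alpha> * beta c * \<epsilon>r) \<le> 4 * (avg_degree G / (c * \<alpha> * \<epsilon>r))"
      by (simp add: mult_ac)
    fix s X
    have "avg_forward_time G (target X) \<alpha> c \<delta> pf \<epsilon>r s
        \<le> ennreal (2 * (n_f \<alpha> c \<delta> pf \<epsilon>r / (\<alpha> * p_min c)))"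
      by (rule avg_forward_time_le[OF \<delta> \<alpha> c pf \<epsilon>r])
    also have "\<dots> \<le> ennreal (4 * (n_f \<alpha> c \<delta> pf \<epsilon>r / (\<alpha> * p_min c)))"
      using n_f_nonneg[OF \<delta> \<alpha> c pf \<epsilon>r] \<alpha> p_min_in[OF c]
      by (intro ennreal_leI mult_right_mono) auto
    finally show "avg_forward_time G (target X) \<alpha> c \<delta> pf \<epsilon>r s
        \<le> ennreal (4 * (n_f \<alpha> c \<delta> pf \<epsilon>r / (\<alpha> * p_min c)))" .
  qed simp
next
  show ?simplified
  proof (intro ballI allI impI)
    fix q \<kappa> :: real
    assume q: "q \<in> {0<..<1}" and \<kappa>: "\<kappa> > 0"
    let ?C = "270 * (ln 3 / ln (1 / q) + \<kappa> + 1) * (ln 2 / ln (1 / q) + 1)"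
    have "ln (1 / q) > 0" using q by simp
    then have "?C > 0" using \<kappa> by (intro mult_pos_pos add_pos_pos divide_pos_pos) auto
    then show "\<exists>C>0. \<forall>\<delta> \<alpha> c pf \<epsilon>r :: real.
        \<delta> \<in> {0<..<1} \<longrightarrow> \<alpha> \<in> {0<..<1} \<longrightarrow> c \<in> {0<..<1} \<longrightarrow> pf \<in> {0<..<1} \<longrightarrow> \<epsilon>r > 0 \<longrightarrow>
        \<delta> \<le> q \<longrightarrow> pf \<le> q \<longrightarrow> \<delta> powr \<kappa> \<le> c \<longrightarrow>
        n_f \<alpha> c \<delta> pf \<epsilon>r / (\<alpha> * p_min c)
          \<le> C * (ln (1 / pf) * ln (1 / \<delta>) /
                 (c ^ 3 * \<alpha> * eps_f \<delta> \<epsilon>r * ln (1 / (1 - \<alpha>))))"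
      using n_f_le[OF q \<kappa>] by blast
  qed
qed

end
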